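(* Let $G=(V,E)$ be a locally finite graph with a countable vertex set $V$. Then $\mathrm{P}[T_2(G)\text{ has an infinite connected component}]=0$.
   Context: Layers model: given a graph $G=(V,E)$, let $(X_v)_{v\in V}$ be i.i.d. Uniform$[0,1]$ random variables ("ages"). For an integer $k\ge1$, $T_k(G)$ is the (random) set of vertices $v$ having at most $k-1$ neighbors $u$ with $X_u<X_v$; $T_k(G)$ also denotes the subgraph of $G$ induced on this set. Locally finite means every vertex has finite degree. *)

theory Defs
  imports "HOL-Probability.Probability" "Graph_Theory.Digraph_Component"
begin

(* A simple undirected graph, possibly infinite, is a G :: 'a pair_pre_digraph satisfying
   pair_bidirected_digraph: both orientations of every edge are present and there are no loops.
   Its connected components are then the strongly connected components pre_digraph.sccs. *)

definition neighbors :: "'a pair_pre_digraph \<Rightarrow> 'a \<Rightarrow> 'a set" where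
  "neighbors G v = {u. (v, u) \<in> parcs G}"

definition locally_finite_graph :: "'a pair_pre_digraph \<Rightarrow> bool" where
  "locally_finite_graph G \<longleftrightarrow> (\<forall>v \<in> pverts G. finite (neighbors G v))"

(* Meant for k \<ge> 1. The finiteness conjunct, automatic in locally finite graphs, is there
   because card is 0 on infinite sets. *)
definition layer_verts :: "nat \<Rightarrow> 'a pair_pre_digraph \<Rightarrow> ('a \<Rightarrow> real) \<Rightarrow> 'a set" where
  "layer_verts k G x = {v \<in> pverts G.
     finite {u \<in> neighbors G v. x u < x v} \<and> card {u \<in> neighbors G v. x u < x v} \<le> k - 1}"

definition layer_graph ::
  "nat \<Rightarrow> 'a pair_pre_digraph \<Rightarrow> ('a \<Rightarrow> real) \<Rightarrow> ('a, 'a \<times> 'a) pre_digraph" where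
  "layer_graph k G x = with_proj G \<restriction> layer_verts k G x"

definition has_infinite_component :: "('a, 'b) pre_digraph \<Rightarrow> bool" where
  "has_infinite_component H \<longleftrightarrow> (\<exists>C \<in> pre_digraph.sccs H. infinite (verts C))"

definition iid_uniform_ages :: "'w measure \<Rightarrow> 'a set \<Rightarrow> ('a \<Rightarrow> 'w \<Rightarrow> real) \<Rightarrow> bool" where
  "iid_uniform_ages M V X \<longleftrightarrow>
     prob_space.indep_vars M (\<lambda>_. borel) X V \<and>
     (\<forall>v \<in> V. distr M borel (X v) = uniform_measure lborel {0..1})"

end

theory Submission
  imports Defs
begin

text \<open>A vertex of \<open>T\<^sub>2\<close> has at most one smaller neighbour. If all ages are distinct, a component of
  \<open>T\<^sub>2\<close> containing no infinite decreasing path has a root from which every vertex is reached by an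
  increasing path. So it suffices to exclude arbitrarily long monotone paths from a fixed vertex.

  Along a monotone path \<open>v\<^sub>0, v\<^sub>1, \<dots>\<close> in \<open>T\<^sub>2\<close> the vertex \<open>v\<^sub>i\<^sub>+\<^sub>1\<close> lies in the set of those \<open>m\<close> neighbours of
  \<open>v\<^sub>i\<close> that are not neighbours of an earlier vertex, and the other \<open>m - 1\<close> elements of this set
  are at least as old as \<open>v\<^sub>i\<close>. These sets are disjoint, so the expected number of paths can be
  bounded one step at a time. Given that the age of \<open>v\<^sub>i\<close> is \<open>t\<close>, an increasing step costs the factor
  \<open>m (1 - t)\<^bsup>m - 1\<^esup>\<close> integrated over the next age, which after \<open>k\<close> steps leads to the bound
  \<open>(1 - t)\<^bsup>k\<^esup>\<close>; a decreasing step costs \<open>m (1 - t)\<^bsup>m - 1\<^esup> t \<le> max t (5/6)\<close>. Averaging over the age of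
  the starting vertex, both bounds tend to 0.\<close>

section \<open>Uniform distribution and product measures\<close>

abbreviation unif :: "real measure" where
  "unif \<equiv> uniform_measure lborel {0..1}"

lemma prob_space_unif: "prob_space unif"
  by (rule prob_space_uniform_measure) auto

lemma nn_integral_unif:
  assumes "f \<in> borel_measurable borel"
  shows "(\<integral>\<^sup>+s. f s \<partial>unif) = (\<integral>\<^sup>+s. f s * indicator {0..1} s \<partial>lborel)"
  using assms by (subst nn_integral_uniform_measure) (auto simp: divide_ennreal_def)

lemma nn_integral_power_Icc:
  fixes a b :: real
  assumes "a \<le> b"
  shows "(\<integral>\<^sup>+s. ennreal ((b - s) ^ k) * indicator {a..b} s \<partial>lborel) = ennreal ((b - a) ^ Suc k / Suc k)"
proof -
  have "(\<integral>\<^sup>+s. ennreal ((b - s) ^ k) * indicator {a..b} s \<partial>lborel)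
      = ennreal (- ((b - b) ^ Suc k / Suc k) - - ((b - a) ^ Suc k / Suc k))"
    by (rule nn_integral_FTC_Icc)
       (use assms in \<open>auto intro!: derivative_eq_intros simp del: power_Suc of_nat_Suc\<close>)
  then show ?thesis by simp
qed

lemma nn_integral_PiM_split:
  assumes M: "\<And>i. i \<in> I \<Longrightarrow> prob_space (M i)" and u: "u \<in> I"
    and f: "f \<in> borel_measurable (PiM I M)"
  shows "(\<integral>\<^sup>+x. f x \<partial>PiM I M) = (\<integral>\<^sup>+s. \<integral>\<^sup>+x. f (x(u := s)) \<partial>PiM (I - {u}) M \<partial>M u)"
proof -
  interpret R: prob_space "PiM (I - {u}) M" using M by (intro prob_space_PiM) auto
  have I: "insert u (I - {u}) = I" using u by auto
  have eq: "PiM I M = distr (M u \<Otimes>\<^sub>M PiM (I - {u}) M) (PiM I M) (\<lambda>(s, x). x(u := s))"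
    using distr_pair_PiM_eq_PiM[of "I - {u}" M u] M u unfolding I by simp
  have m: "(\<lambda>(s, x). x(u := s)) \<in> M u \<Otimes>\<^sub>M PiM (I - {u}) M \<rightarrow>\<^sub>M PiM I M"
    using measurable_fun_upd[of I "I - {u}" u snd "M u \<Otimes>\<^sub>M PiM (I - {u}) M" M fst] I
    by (auto simp: case_prod_beta)
  have "(\<integral>\<^sup>+x. f x \<partial>PiM I M) = (\<integral>\<^sup>+p. f (case p of (s, x) \<Rightarrow> x(u := s)) \<partial>(M u \<Otimes>\<^sub>M PiM (I - {u}) M))"
    by (subst eq) (rule nn_integral_distr[OF m], use f in simp)
  also have "\<dots> = (\<integral>\<^sup>+s. \<integral>\<^sup>+x. f (x(u := s)) \<partial>PiM (I - {u}) M \<partial>M u)"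
    using R.nn_integral_fst[OF measurable_compose[OF m f]] by simp
  finally show ?thesis .
qed

lemma measurable_upd_coordinate:
  assumes "u \<in> I" "s \<in> space (M u)"
  shows "(\<lambda>x. x(u := s)) \<in> PiM I M \<rightarrow>\<^sub>M PiM I M"
  using assms by (intro measurable_fun_upd[where J = I]) auto

text \<open>The inner integrand ignores the old value at \<open>u\<close>, so that coordinate
  contributes only its total mass 1. Keeping the index set unchanged lets all later conditioning
  take place on one measure.\<close>

lemma nn_integral_PiM_resample:
  assumes M: "\<And>i. i \<in> I \<Longrightarrow> prob_space (M i)" and u: "u \<in> I"
    and f: "f \<in> borel_measurable (PiM I M)"
  shows "(\<integral>\<^sup>+x. f x \<partial>PiM I M) = (\<integral>\<^sup>+s. \<integral>\<^sup>+x. f (x(u := s)) \<partial>PiM I M \<partial>M u)"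
proof -
  interpret U: prob_space "M u" using M u by auto
  have "(\<integral>\<^sup>+x. f (x(u := s)) \<partial>PiM I M) = (\<integral>\<^sup>+x. f (x(u := s)) \<partial>PiM (I - {u}) M)"
    if "s \<in> space (M u)" for s
    by (subst nn_integral_PiM_split[OF M u])
       (auto intro!: measurable_compose[OF measurable_upd_coordinate f] u that simp: U.emeasure_space_1)
  then show ?thesis
    unfolding nn_integral_PiM_split[OF M u f, simplified]
    by (intro nn_integral_cong) simp
qed

text \<open>The left side is the probability that exactly one of \<open>m\<close> independent
  uniform variables falls below \<open>t\<close>. For \<open>m = 1\<close> it is \<open>t\<close>;
  for larger \<open>m\<close>, with \<open>y = (m - 1) * t\<close>, it is at most
  \<open>2 * y * exp (- y)\<close>, which never exceeds 5/6.\<close>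

lemma binomial_one_bound:
  fixes t :: real
  assumes "0 \<le> t" "t \<le> 1"
  shows "real m * (1 - t) ^ (m - 1) * t \<le> max t (5/6)"
proof (cases "m \<le> 1")
  case True
  then have "m = 0 \<or> m = 1" by auto
  then show ?thesis using assms by auto
next
  case False
  define n where "n = m - 1"
  have n: "m = Suc n" "1 \<le> n" using False by (auto simp: n_def)
  define y where "y = real n * t"
  have y: "0 \<le> y" using assms by (simp add: y_def)
  have "(1 - t) ^ n \<le> exp (- t) ^ n"
    using assms exp_ge_add_one_self[of "- t"] by (intro power_mono) auto
  also have "\<dots> = exp (- y)" by (simp add: y_def flip: exp_of_nat_mult)
  finally have 1: "(1 - t) ^ n \<le> exp (- y)" .
  \<comment> \<open>The difference \<open>5 * (1 + y + y\<^sup>2 / 2) - 12 * y\<close> is one tenth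
    of this.\<close>
  have "0 \<le> (5 * y - 7)\<^sup>2 + 1" by simp
  then have "12 * y \<le> 5 * (1 + y + y\<^sup>2 / 2)" by (simp add: power2_eq_square algebra_simps)
  also have "\<dots> \<le> 5 * exp y" using exp_lower_Taylor_quadratic[OF y] by simp
  finally have 2: "2 * y * exp (- y) \<le> 5/6" by (simp add: exp_minus field_simps)
  have "real m * t \<le> 2 * y"
    using n assms mult_right_mono[of 1 "real n" t] by (simp add: y_def algebra_simps)
  then have "real m * (1 - t) ^ (m - 1) * t \<le> 2 * y * exp (- y)"
    using 1 y assms mult_mono[of "real m * t" "2 * y" "(1 - t) ^ n" "exp (- y)"]
    by (simp add: n mult_ac)
  with 2 show ?thesis by simp
qed

lemma nn_integral_unif_bound:
  assumes "f \<in> borel_measurable borel" "\<And>s. 0 \<le> s \<Longrightarrow> s \<le> 1 \<Longrightarrow> f s \<le> g s"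
  shows "(\<integral>\<^sup>+s. f s \<partial>unif) \<le> (\<integral>\<^sup>+s. g s * indicator {0..1} s \<partial>lborel)"
  unfolding nn_integral_unif[OF assms(1)]
  by (intro nn_integral_mono) (auto simp: assms(2) split: split_indicator)

lemma emeasure_unif_atLeast:
  assumes "0 \<le> t" "t \<le> 1"
  shows "emeasure unif {t..} = ennreal (1 - t)"
proof -
  have "{0..1} \<inter> {t..} = {t..1}" using assms by auto
  then show ?thesis using assms by (simp add: divide_ennreal_def)
qed

lemma emeasure_unif_lessThan:
  assumes "0 \<le> t" "t \<le> 1"
  shows "emeasure unif {..<t} = ennreal t"
proof -
  have "{0..1} \<inter> {..<t} = {0..<t}" using assms by auto
  then show ?thesis using assms by (simp add: divide_ennreal_def)
qed

section \<open>Independent uniform ages and resampling\<close>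

locale age_space =
  fixes V :: "'a set" and N :: "'a \<Rightarrow> 'a set"
  assumes N_subset: "v \<in> V \<Longrightarrow> N v \<subseteq> V"
    and finite_N: "v \<in> V \<Longrightarrow> finite (N v)"
begin

definition ages :: "('a \<Rightarrow> real) measure" where
  "ages = PiM V (\<lambda>_. unif)"

lemma prob_space_ages: "prob_space ages"
  unfolding ages_def by (intro prob_space_PiM prob_space_unif)

lemma age_measurable [measurable]: "v \<in> V \<Longrightarrow> (\<lambda>x. x v) \<in> borel_measurable ages"
  unfolding ages_def
  using measurable_component_singleton[of v V "\<lambda>_. unif"] by (simp cong: measurable_cong_sets)

lemma upd_measurable [measurable]: "v \<in> V \<Longrightarrow> (\<lambda>x. x(v := s)) \<in> ages \<rightarrow>\<^sub>M ages"
  unfolding ages_def by (rule measurable_upd_coordinate) auto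

abbreviation Pr :: "(('a \<Rightarrow> real) \<Rightarrow> bool) \<Rightarrow> ennreal" where
  "Pr E \<equiv> emeasure ages {x \<in> space ages. E x}"

lemma Pr_le_1: "Pr E \<le> 1"
  by (rule prob_space.emeasure_le_1[OF prob_space_ages])

lemma Pr_mono:
  assumes "Measurable.pred ages F" "\<And>x. E x \<Longrightarrow> F x"
  shows "Pr E \<le> Pr F"
  using assms by (intro emeasure_mono) auto

text \<open>Conditioning on the age of \<open>v\<close>: by independence, fixing it to
  \<open>s\<close> leaves the law of the other ages unchanged.\<close>

lemma Pr_resample:
  assumes v: "v \<in> V" and [measurable]: "Measurable.pred ages E"
  shows "Pr E = (\<integral>\<^sup>+s. Pr (\<lambda>x. E (x(v := s))) \<partial>unif)"
proof -
  have "Pr E = (\<integral>\<^sup>+x. indicator {x \<in> space ages. E x} x \<partial>ages)" by simp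
  also have "\<dots> = (\<integral>\<^sup>+s. \<integral>\<^sup>+x. indicator {x \<in> space ages. E x} (x(v := s)) \<partial>ages \<partial>unif)"
    unfolding ages_def
    by (rule nn_integral_PiM_resample) (auto intro: v prob_space_unif simp flip: ages_def)
  also have "\<dots> = (\<integral>\<^sup>+s. Pr (\<lambda>x. E (x(v := s))) \<partial>unif)"
  proof (intro nn_integral_cong)
    fix s
    have "(\<integral>\<^sup>+x. indicator {x \<in> space ages. E x} (x(v := s)) \<partial>ages)
        = (\<integral>\<^sup>+x. indicator {x \<in> space ages. E (x(v := s))} x \<partial>ages)"
      by (intro nn_integral_cong)
         (auto simp: indicator_def measurable_space[OF upd_measurable[OF v]])
    also have "\<dots> = Pr (\<lambda>x. E (x(v := s)))" using v by (subst nn_integral_indicator) auto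
    finally show "(\<integral>\<^sup>+x. indicator {x \<in> space ages. E x} (x(v := s)) \<partial>ages) = Pr (\<lambda>x. E (x(v := s)))" .
  qed
  finally show ?thesis .
qed

lemma Pr_resample_measurable:
  assumes v: "v \<in> V" and [measurable]: "Measurable.pred ages E"
  shows "(\<lambda>s. Pr (\<lambda>x. E (x(v := s)))) \<in> borel_measurable borel"
proof -
  interpret A: prob_space ages by (rule prob_space_ages)
  have "(\<lambda>p. (snd p)(v := fst p)) \<in> unif \<Otimes>\<^sub>M ages \<rightarrow>\<^sub>M ages"
    unfolding ages_def by (rule measurable_fun_upd[where J = V]) (use v in auto)
  from measurable_compose[OF this assms(2)]
  have "{p \<in> space (unif \<Otimes>\<^sub>M ages). E ((snd p)(v := fst p))} \<in> sets (unif \<Otimes>\<^sub>M ages)"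
    by measurable
  then have "(\<lambda>s. Pr (\<lambda>x. E (x(v := s)))) \<in> borel_measurable unif"
    by (intro A.measurable_emeasure)
       (auto simp: space_pair_measure conj_assoc Collect_conj_eq elim!: back_subst[of "\<lambda>A. A \<in> _"])
  then show ?thesis by (simp cong: measurable_cong_sets)
qed

section \<open>Monotone chains and bounds on their probability\<close>

text \<open>\<open>W\<close> collects the excluded vertices; each step moves to a fresh neighbour
  and then excludes all of \<open>N v\<close>. Apart from the age of the current vertex, successive
  steps thus inspect disjoint sets of ages, which allows their bounds to be multiplied. With
  \<open>(>)\<close>, \<open>u\<close> is the only fresh neighbour younger than \<open>v\<close>;
  with \<open>(<)\<close> there is none.\<close>

primrec chain :: "(real \<Rightarrow> real \<Rightarrow> bool) \<Rightarrow> nat \<Rightarrow> 'a set \<Rightarrow> 'a \<Rightarrow> ('a \<Rightarrow> real) \<Rightarrow> bool" where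
  "chain r 0 W v x \<longleftrightarrow> True"
| "chain r (Suc k) W v x \<longleftrightarrow> (\<exists>u \<in> N v - W. r (x v) (x u) \<and>
     (\<forall>w \<in> N v - W - {u}. x v \<le> x w) \<and> chain r k (W \<union> N v) u x)"

text \<open>Beyond the age of its starting vertex a chain reads only ages outside \<open>W\<close>,
  and \<open>W\<close> only grows. In the induction the next vertex differs from \<open>w\<close>
  because it is taken outside \<open>W\<close>.\<close>

lemma chain_upd:
  "w \<in> W \<Longrightarrow> w \<noteq> v \<Longrightarrow> chain r k W v (x(w := s)) \<longleftrightarrow> chain r k W v x"
proof (induction k arbitrary: W v)
  case (Suc k)
  define y where "y = x(w := s)"
  have "chain r k (W \<union> N v) u y \<longleftrightarrow> chain r k (W \<union> N v) u x" if "u \<in> N v - W" for u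
    unfolding y_def using Suc.IH[of "W \<union> N v" u] Suc.prems that by (auto simp del: fun_upd_apply)
  moreover have "y v = x v" and "y z = x z" if "z \<in> N v - W" for z
    using that Suc.prems by (auto simp: y_def)
  ultimately show ?case
    unfolding y_def[symmetric] chain.simps by (intro bex_cong conj_cong ball_cong refl) auto
qed simp

lemma chain_measurable [measurable]:
  assumes r: "r = (<) \<or> r = (>)"
  shows "v \<in> V \<Longrightarrow> Measurable.pred ages (chain r k W v)"
proof (induction k arbitrary: W v)
  case (Suc k)
  have fin: "finite (N v)" and sub: "N v \<subseteq> V" using Suc.prems finite_N N_subset by auto
  have *: "Measurable.pred ages (\<lambda>x. r (x v) (x u))" if "u \<in> V" for u
    using r that Suc.prems by auto
  have **: "Measurable.pred ages (\<lambda>x. x v \<le> x u)" if "u \<in> V" for u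
  proof -
    have [measurable]: "u \<in> V" "v \<in> V" using that Suc.prems by auto
    show ?thesis unfolding not_less[symmetric] by measurable
  qed
  show ?case
    unfolding chain.simps
    by (intro pred_intros_finite pred_intros_logic * ** Suc.IH) (use fin sub in auto)
qed (unfold chain.simps, simp)

text \<open>Independence, obtained by resampling the vertices of \<open>B\<close> one at a time:
  \<open>E\<close> ignores their ages, so each contributes a factor \<open>1 - t\<close>.\<close>

lemma Pr_restrict_ge:
  assumes "finite B" "B \<subseteq> V" "0 \<le> t" "t \<le> 1"
    and [measurable]: "Measurable.pred ages E"
    and upd: "\<And>w x s. w \<in> B \<Longrightarrow> E (x(w := s)) \<longleftrightarrow> E x"
  shows "Pr (\<lambda>x. (\<forall>w\<in>B. t \<le> x w) \<and> E x) = ennreal ((1 - t) ^ card B) * Pr E"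
  using assms(1,2) upd
proof (induction B rule: finite_induct)
  case (insert w B)
  let ?F = "\<lambda>x. (\<forall>w\<in>B. t \<le> x w) \<and> E x"
  have w[measurable]: "w \<in> V" using insert by auto
  have "Measurable.pred ages (\<lambda>x. t \<le> x w')" if [measurable]: "w' \<in> V" for w' by measurable
  then have [measurable]: "Measurable.pred ages ?F"
    using insert by (intro pred_intros_logic pred_intros_finite) auto
  have "Pr (\<lambda>x. (\<forall>w\<in>insert w B. t \<le> x w) \<and> E x) = Pr (\<lambda>x. t \<le> x w \<and> ?F x)" by (simp add: conj_assoc)
  also have "\<dots> = (\<integral>\<^sup>+s. Pr (\<lambda>x. t \<le> s \<and> ?F x) \<partial>unif)"
  proof -
    have upd: "?F (x(w := s)) \<longleftrightarrow> ?F x" for x s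
    proof -
      have "(x(w := s)) w' = x w'" if "w' \<in> B" for w' using insert that by auto
      then show ?thesis using insert.prems(2)[of w x s] by (auto simp del: fun_upd_apply)
    qed
    have "Measurable.pred ages (\<lambda>x. t \<le> x w \<and> ?F x)" by measurable
    from Pr_resample[OF w this] show ?thesis unfolding upd fun_upd_same .
  qed
  also have "\<dots> = (\<integral>\<^sup>+s. Pr ?F * indicator {t..} s \<partial>unif)"
    by (intro nn_integral_cong) (auto split: split_indicator)
  also have "\<dots> = Pr ?F * ennreal (1 - t)"
    using emeasure_unif_atLeast[OF assms(3,4)] by (subst nn_integral_cmult_indicator) auto
  also have "Pr ?F = ennreal ((1 - t) ^ card B) * Pr E" using insert by auto
  finally show ?case using insert assms by (simp add: ennreal_mult' mult_ac)
qed simp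

definition chain_prob :: "(real \<Rightarrow> real \<Rightarrow> bool) \<Rightarrow> nat \<Rightarrow> 'a set \<Rightarrow> 'a \<Rightarrow> real \<Rightarrow> ennreal" where
  "chain_prob r k W v s = Pr (\<lambda>x. chain r k W v (x(v := s)))"

lemma chain_prob_measurable [measurable]:
  assumes "r = (<) \<or> r = (>)" "v \<in> V"
  shows "chain_prob r k W v \<in> borel_measurable borel"
  unfolding chain_prob_def by (rule Pr_resample_measurable) (use assms in auto)

text \<open>Union bound over the next vertex \<open>u\<close>, whose age is resampled as
  \<open>s\<close>. The other fresh neighbours lie in \<open>W \<union> N v\<close>, so the rest of
  the chain ignores their ages, and each of these is at least \<open>t\<close> with probability
  \<open>1 - t\<close>.\<close>

lemma chain_prob_Suc_le:
  assumes r: "r = (<) \<or> r = (>)" and v: "v \<in> V" "v \<in> W" and t: "0 \<le> t" "t \<le> 1"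
  shows "chain_prob r (Suc k) W v t \<le> (\<Sum>u\<in>N v - W. ennreal ((1 - t) ^ (card (N v - W) - 1)) *
     (\<integral>\<^sup>+s. indicator {s. r t s} s * chain_prob r k (W \<union> N v) u s \<partial>unif))"
proof -
  define F where "F = N v - W"
  define W' where "W' = W \<union> N v"
  have F: "finite F" "F \<subseteq> V" "F \<subseteq> W'" "v \<notin> F" "v \<in> W'"
    using v N_subset finite_N by (auto simp: F_def W'_def)
  let ?E = "\<lambda>u x. r t (x u) \<and> (\<forall>w\<in>F - {u}. t \<le> x w) \<and> chain r k W' u x"
  have rm: "{s. r t s} \<in> sets borel" using r by auto
  have m[measurable]: "Measurable.pred ages (?E u)" if "u \<in> F" for u
  proof (intro pred_intros_logic pred_intros_finite chain_measurable[OF r])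
    show "Measurable.pred ages (\<lambda>x. r t (x u))" using r that F by auto
  qed (use F that in auto)
  have "chain_prob r (Suc k) W v t \<le> Pr (\<lambda>x. \<exists>u\<in>F. ?E u x)"
    unfolding chain_prob_def
  proof (rule Pr_mono)
    show "Measurable.pred ages (\<lambda>x. \<exists>u\<in>F. ?E u x)" using F by (intro pred_intros_finite m)
    fix x assume "chain r (Suc k) W v (x(v := t))"
    then obtain u where u: "u \<in> F" "r t ((x(v := t)) u)" "\<forall>w\<in>F - {u}. t \<le> (x(v := t)) w"
      "chain r k W' u (x(v := t))"
      by (auto simp: F_def W'_def)
    have "(x(v := t)) w = x w" if "w \<in> F" for w using that F by auto
    moreover have "u \<noteq> v" using u F by auto
    ultimately have "?E u x" using u F chain_upd[of v W' u r k x t] by (auto simp del: fun_upd_apply)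
    then show "\<exists>u\<in>F. ?E u x" using u by auto
  qed
  also have "\<dots> = emeasure ages (\<Union>u\<in>F. {x \<in> space ages. ?E u x})"
    by (intro arg_cong[where f = "emeasure ages"]) auto
  also have "\<dots> \<le> (\<Sum>u\<in>F. Pr (?E u))"
    using F m by (intro emeasure_subadditive_finite) auto
  also have "\<dots> = (\<Sum>u\<in>F. ennreal ((1 - t) ^ (card F - 1)) *
     (\<integral>\<^sup>+s. indicator {s. r t s} s * chain_prob r k W' u s \<partial>unif))"
  proof (intro sum.cong refl)
    fix u assume u: "u \<in> F"
    then have uV: "u \<in> V" using F by auto
    have "Pr (?E u) = (\<integral>\<^sup>+s. Pr (\<lambda>x. ?E u (x(u := s))) \<partial>unif)"
      using u F by (intro Pr_resample m) auto
    also have "\<dots> = (\<integral>\<^sup>+s. ennreal ((1 - t) ^ (card F - 1)) *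
        (indicator {s. r t s} s * chain_prob r k W' u s) \<partial>unif)"
    proof (intro nn_integral_cong)
      fix s
      have "Pr (\<lambda>x. ?E u (x(u := s))) = indicator {s. r t s} s *
          Pr (\<lambda>x. (\<forall>w\<in>F - {u}. t \<le> x w) \<and> chain r k W' u (x(u := s)))"
        by (auto split: split_indicator)
      also have "Pr (\<lambda>x. (\<forall>w\<in>F - {u}. t \<le> x w) \<and> chain r k W' u (x(u := s)))
          = ennreal ((1 - t) ^ card (F - {u})) * chain_prob r k W' u s"
        unfolding chain_prob_def
      proof (intro Pr_restrict_ge)
        show "chain r k W' u ((x(w := s'))(u := s)) \<longleftrightarrow> chain r k W' u (x(u := s))"
          if "w \<in> F - {u}" for w x s'
          using that F chain_upd[of w W' u r k "x(u := s)" s'] by (auto simp: fun_upd_twist)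
        show "Measurable.pred ages (\<lambda>x. chain r k W' u (x(u := s)))"
          using uV r by measurable
      qed (use F t in auto)
      finally show "Pr (\<lambda>x. ?E u (x(u := s))) =
          ennreal ((1 - t) ^ (card F - 1)) * (indicator {s. r t s} s * chain_prob r k W' u s)"
        using u F by (simp add: mult_ac del: fun_upd_apply)
    qed
    also have "\<dots> = ennreal ((1 - t) ^ (card F - 1)) *
        (\<integral>\<^sup>+s. indicator {s. r t s} s * chain_prob r k W' u s \<partial>unif)"
    proof (rule nn_integral_cmult)
      have "(\<lambda>s. indicator {s. r t s} s * chain_prob r k W' u s) \<in> borel_measurable borel"
        using rm chain_prob_measurable[OF r uV] by (intro borel_measurable_times_ennreal) auto
      then show "(\<lambda>s. indicator {s. r t s} s * chain_prob r k W' u s) \<in> borel_measurable unif"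
        by (simp cong: measurable_cong_sets)
    qed
    finally show "Pr (?E u) = \<dots>" .
  qed
  finally show ?thesis unfolding F_def W'_def .
qed

text \<open>The starting age is integrated out because only this absorbs the unbounded factor
  \<open>m\<close>: one step gives the integrand \<open>m * (1 - s) ^ (m + k)\<close>, whose
  integral over \<open>[t, 1]\<close> is \<open>m / (m + k + 1) * (1 - t) ^ (m + k + 1)\<close>. For
  \<open>m \<ge> 1\<close> this is at most \<open>(1 - t) ^ (k + 2)\<close>.\<close>

lemma increasing_chain_integral_le:
  assumes "v \<in> V" "v \<in> W" "0 \<le> t" "t \<le> 1"
  shows "(\<integral>\<^sup>+s. indicator {s. t < s} s * chain_prob (<) k W v s \<partial>unif) \<le> ennreal ((1 - t) ^ Suc k)"
  using assms
proof (induction k arbitrary: W v t)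
  case 0
  have "(\<integral>\<^sup>+s. indicator {s. t < s} s * chain_prob (<) 0 W v s \<partial>unif) \<le> (\<integral>\<^sup>+s. indicator {t..} s \<partial>unif)"
    using prob_space.emeasure_space_1[OF prob_space_ages]
    by (intro nn_integral_mono) (auto simp: chain_prob_def split: split_indicator)
  also have "\<dots> = ennreal (1 - t)" using 0 by (simp add: emeasure_unif_atLeast del: emeasure_uniform_measure)
  finally show ?case by simp
next
  case (Suc k)
  define m where "m = card (N v - W)"
  have le: "chain_prob (<) (Suc k) W v s \<le> ennreal (real m * (1 - s) ^ (m + k))" if s: "0 \<le> s" "s \<le> 1" for s
  proof -
    have "chain_prob (<) (Suc k) W v s \<le> (\<Sum>u\<in>N v - W. ennreal ((1 - s) ^ (m - 1)) * ennreal ((1 - s) ^ Suc k))"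
      unfolding m_def
    proof (rule order_trans[OF chain_prob_Suc_le], goal_cases)
      case 6
      show ?case
        by (intro sum_mono mult_left_mono Suc.IH) (use Suc.prems s N_subset in auto)
    qed (use Suc.prems s in auto)
    also have "\<dots> = ennreal (real m * ((1 - s) ^ (m - 1) * (1 - s) ^ Suc k))"
      using s by (simp add: m_def ennreal_mult ennreal_of_nat_eq_real_of_nat)
    \<comment> \<open>Truncated subtraction is harmless: for \<open>m = 0\<close> both sides
      vanish.\<close>
    also have "real m * ((1 - s) ^ (m - 1) * (1 - s) ^ Suc k) = real m * (1 - s) ^ (m + k)"
      by (cases m) (simp_all add: power_add)
    finally show ?thesis .
  qed
  have "(\<integral>\<^sup>+s. indicator {s. t < s} s * chain_prob (<) (Suc k) W v s \<partial>unif)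
     \<le> (\<integral>\<^sup>+s. (indicator {t<..} s * ennreal (real m * (1 - s) ^ (m + k))) * indicator {0..1} s \<partial>lborel)"
    using Suc.prems by (intro nn_integral_unif_bound) (auto intro!: le split: split_indicator)
  also have "\<dots> \<le> (\<integral>\<^sup>+s. ennreal (real m) * (ennreal ((1 - s) ^ (m + k)) * indicator {t..1} s) \<partial>lborel)"
    by (intro nn_integral_mono) (auto simp: ennreal_mult split: split_indicator)
  also have "\<dots> = ennreal (real m) * ennreal ((1 - t) ^ Suc (m + k) / Suc (m + k))"
    using Suc.prems by (subst nn_integral_cmult) (auto simp: nn_integral_power_Icc)
  also have "\<dots> \<le> ennreal ((1 - t) ^ Suc (Suc k))"
  proof (cases "m = 0")
    case False
    have "real m / Suc (m + k) \<le> 1" by (simp add: field_simps)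
    then have "real m / Suc (m + k) * (1 - t) ^ Suc (m + k) \<le> 1 * (1 - t) ^ Suc (Suc k)"
      using Suc.prems False by (intro mult_mono power_decreasing) auto
    then show ?thesis using Suc.prems
      by (subst ennreal_mult[symmetric]) (auto intro!: ennreal_leI)
  qed simp
  finally show ?case .
qed

text \<open>Here a pointwise bound suffices: the next age ranges below \<open>t\<close> and
  contributes a factor \<open>t\<close>, so \<open>binomial_one_bound\<close> applies to each step.
  Since ages decrease and \<open>max s (5/6)\<close> is monotone in \<open>s\<close>, the constant
  for \<open>t\<close> serves all later steps.\<close>

lemma decreasing_chain_le:
  assumes "v \<in> V" "v \<in> W" "0 \<le> t" "t \<le> 1"
  shows "chain_prob (>) k W v t \<le> ennreal (max t (5/6) ^ k)"
  using assms
proof (induction k arbitrary: W v t)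
  case 0
  then show ?case using Pr_le_1[of "\<lambda>_. True"] by (simp add: chain_prob_def)
next
  case (Suc k)
  define m where "m = card (N v - W)"
  let ?c = "max t (5/6)"
  have int: "(\<integral>\<^sup>+s. indicator {s. t > s} s * chain_prob (>) k (W \<union> N v) u s \<partial>unif) \<le> ennreal (?c ^ k * t)"
    if u: "u \<in> N v" for u
  proof -
    have [measurable]: "u \<in> V" using u Suc.prems N_subset by auto
    have "chain_prob (>) k (W \<union> N v) u s \<le> ennreal (?c ^ k)" if "0 \<le> s" "s < t" for s
    proof -
      have "chain_prob (>) k (W \<union> N v) u s \<le> ennreal (max s (5/6) ^ k)"
        using Suc.IH[of u "W \<union> N v" s] Suc.prems u that N_subset by auto
      also have "\<dots> \<le> ennreal (?c ^ k)" using that by (intro ennreal_leI power_mono) auto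
      finally show ?thesis .
    qed
    then have "(\<integral>\<^sup>+s. indicator {s. t > s} s * chain_prob (>) k (W \<union> N v) u s \<partial>unif)
        \<le> (\<integral>\<^sup>+s. (ennreal (?c ^ k) * indicator {..<t} s) * indicator {0..1} s \<partial>lborel)"
      using Suc.prems u N_subset by (intro nn_integral_unif_bound) (auto split: split_indicator)
    also have "\<dots> = (\<integral>\<^sup>+s. ennreal (?c ^ k) * indicator {..<t} s \<partial>unif)"
      by (rule nn_integral_unif[symmetric]) auto
    also have "\<dots> = ennreal (?c ^ k) * ennreal t"
      using Suc.prems emeasure_unif_lessThan[of t] by (subst nn_integral_cmult_indicator) auto
    finally show ?thesis using Suc.prems by (simp add: ennreal_mult)
  qed
  have "chain_prob (>) (Suc k) W v t \<le> (\<Sum>u\<in>N v - W. ennreal ((1 - t) ^ (m - 1)) * ennreal (?c ^ k * t))"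
    unfolding m_def
  proof (rule order_trans[OF chain_prob_Suc_le], goal_cases)
    case 6
    show ?case by (intro sum_mono mult_left_mono int) auto
  qed (use Suc.prems in auto)
  also have "\<dots> = ennreal (real m * ((1 - t) ^ (m - 1) * (?c ^ k * t)))"
    using Suc.prems by (simp add: m_def ennreal_mult ennreal_of_nat_eq_real_of_nat)
  also have "real m * ((1 - t) ^ (m - 1) * (?c ^ k * t)) = (real m * (1 - t) ^ (m - 1) * t) * ?c ^ k"
    by (simp add: mult_ac)
  also have "ennreal \<dots> \<le> ennreal (?c * ?c ^ k)"
    using binomial_one_bound[of t m] Suc.prems by (intro ennreal_leI mult_right_mono) auto
  finally show ?case by simp
qed

section \<open>Almost sure finiteness of chains and distinctness of ages\<close>

lemma AE_not_all:
  fixes b :: "nat \<Rightarrow> real"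
  assumes m: "\<And>k. Measurable.pred ages (E k)" and le: "\<And>k. Pr (E k) \<le> ennreal (b k)"
    and b: "b \<longlonglongrightarrow> 0"
  shows "AE x in ages. \<exists>k. \<not> E k x"
proof -
  have [measurable]: "Measurable.pred ages (\<lambda>x. \<forall>k. E k x)" using m by measurable
  have "Pr (\<lambda>x. \<forall>k. E k x) \<le> ennreal (b k)" for k
    by (rule order_trans[OF Pr_mono le]) (use m in auto)
  moreover have "(\<lambda>k. ennreal (b k)) \<longlonglongrightarrow> ennreal 0" by (rule tendsto_ennrealI[OF b])
  ultimately have "Pr (\<lambda>x. \<forall>k. E k x) \<le> ennreal 0"
    by (intro LIMSEQ_le_const[of _ _ "Pr (\<lambda>x. \<forall>k. E k x)"]) auto
  then show ?thesis
    by (intro AE_I[where N = "{x \<in> space ages. \<forall>k. E k x}"]) auto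
qed

lemma AE_decreasing_chain_finite:
  assumes v: "v \<in> V"
  shows "AE x in ages. \<exists>k. \<not> chain (>) k {v} v x"
proof (rule AE_not_all)
  show "Pr (chain (>) k {v} v) \<le> ennreal ((5/6) ^ k + 1 / Suc k)" for k
  proof -
    have "Pr (chain (>) k {v} v) = (\<integral>\<^sup>+s. chain_prob (>) k {v} v s \<partial>unif)"
      unfolding chain_prob_def using v by (intro Pr_resample) auto
    also have "\<dots> \<le> (\<integral>\<^sup>+s. ennreal ((5/6) ^ k + s ^ k) * indicator {0..1} s \<partial>lborel)"
    proof (rule nn_integral_unif_bound)
      fix s :: real assume s: "0 \<le> s" "s \<le> 1"
      \<comment> \<open>Replacing the maximum by a sum makes the integral explicit.\<close>
      have "max s (5/6) ^ k \<le> (5/6) ^ k + s ^ k" using s by (auto simp: max_def)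
      then show "chain_prob (>) k {v} v s \<le> ennreal ((5/6) ^ k + s ^ k)"
        using v s by (intro order_trans[OF decreasing_chain_le ennreal_leI]) auto
    qed (use v in auto)
    also have "\<dots> = ennreal (((5/6) ^ k * 1 + 1 ^ Suc k / Suc k) - ((5/6) ^ k * 0 + 0 ^ Suc k / Suc k))"
      by (rule nn_integral_FTC_Icc)
         (auto intro!: derivative_eq_intros simp del: power_Suc of_nat_Suc)
    finally show ?thesis by simp
  qed
  have "(\<lambda>k. (5/6) ^ k + 1 / real (Suc k)) \<longlonglongrightarrow> 0 + 0"
    by (intro tendsto_add LIMSEQ_power_zero LIMSEQ_Suc lim_1_over_n) auto
  then show "(\<lambda>k. (5/6) ^ k + 1 / real (Suc k)) \<longlonglongrightarrow> 0" by simp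
qed (use v in auto)

text \<open>Excluding all neighbours of \<open>v\<close> but \<open>u\<close> makes the condition on the other neighbours of the
  starting vertex void.\<close>

lemma AE_increasing_chain_finite:
  assumes v: "v \<in> V" "v \<notin> N v" and u: "u \<in> N v"
  shows "AE x in ages. \<exists>k. \<not> chain (<) k (insert v (N v - {u})) v x"
proof -
  define W where "W = insert v (N v - {u})"
  have F: "N v - W = {u}" using v u by (auto simp: W_def)
  have "AE x in ages. \<exists>k. \<not> chain (<) (Suc k) W v x"
  proof (rule AE_not_all)
    show "Pr (chain (<) (Suc k) W v) \<le> ennreal (1 / Suc (Suc k))" for k
    proof -
      have "Pr (chain (<) (Suc k) W v) = (\<integral>\<^sup>+s. chain_prob (<) (Suc k) W v s \<partial>unif)"
        unfolding chain_prob_def using v by (intro Pr_resample chain_measurable) auto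
      also have "\<dots> \<le> (\<integral>\<^sup>+s. ennreal ((1 - s) ^ Suc k) * indicator {0..1} s \<partial>lborel)"
      proof (rule nn_integral_unif_bound)
        fix s :: real assume s: "0 \<le> s" "s \<le> 1"
        \<comment> \<open>With \<open>u\<close> as the only fresh neighbour the exponent
          \<open>card (N v - W) - 1\<close> is 0, so the first step leaves just the integral over
          the age of \<open>u\<close>.\<close>
        have "chain_prob (<) (Suc k) W v s \<le> (\<integral>\<^sup>+t. indicator {t. s < t} t * chain_prob (<) k (W \<union> N v) u t \<partial>unif)"
          using chain_prob_Suc_le[of "(<)" v W s k] v s unfolding F by (simp add: W_def)
        also have "\<dots> \<le> ennreal ((1 - s) ^ Suc k)"
          using s u v N_subset by (intro increasing_chain_integral_le) auto
        finally show "chain_prob (<) (Suc k) W v s \<le> ennreal ((1 - s) ^ Suc k)" .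
      qed (use v in auto)
      also have "\<dots> = ennreal (1 / Suc (Suc k))"
        using nn_integral_power_Icc[of 0 1 "Suc k"] by simp
      finally show ?thesis .
    qed
    show "Measurable.pred ages (chain (<) (Suc k) W v)" for k
      using v by (intro chain_measurable) auto
    show "(\<lambda>k. 1 / real (Suc (Suc k))) \<longlonglongrightarrow> 0"
      by (intro LIMSEQ_Suc lim_1_over_n)
  qed
  then show ?thesis unfolding W_def by eventually_elim blast
qed

text \<open>Resampling both ages reduces the claim to the uniform distribution having no
  atoms.\<close>

lemma AE_age_distinct:
  assumes "u \<in> V" "v \<in> V" "u \<noteq> v"
  shows "AE x in ages. x u \<noteq> x v"
proof -
  have [measurable]: "Measurable.pred ages (\<lambda>x. x u = x v)" "Measurable.pred ages (\<lambda>x. s = x v)" for s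
    unfolding pred_def using assms by (auto intro!: borel_measurable_eq)
  have "Pr (\<lambda>x. x u = x v) = (\<integral>\<^sup>+s. Pr (\<lambda>x. s = x v) \<partial>unif)"
    using assms by (subst Pr_resample[of u]) auto
  also have "\<dots> = (\<integral>\<^sup>+s. \<integral>\<^sup>+s'. Pr (\<lambda>x. s = s') \<partial>unif \<partial>unif)"
    using assms by (intro nn_integral_cong) (subst Pr_resample[of v], auto)
  also have "\<dots> \<le> (\<integral>\<^sup>+s. \<integral>\<^sup>+s'. indicator {s} s' \<partial>unif \<partial>unif)"
    using prob_space.emeasure_space_1[OF prob_space_ages]
    by (intro nn_integral_mono) (auto split: split_indicator)
  also have "\<dots> = 0" by (simp add: emeasure_lborel_countable emeasure_uniform_measure)
  finally show ?thesis
    by (intro AE_I[where N = "{x \<in> space ages. x u = x v}"]) auto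
qed

end

section \<open>Finite reachable sets and countable quantifiers\<close>

lemma finite_relpow_Image:
  fixes R :: "'a rel"
  assumes "\<And>a. finite (R `` {a})"
  shows "finite ((R ^^ n) `` {a})"
proof (induction n)
  case (Suc n)
  have "(R ^^ Suc n) `` {a} = (\<Union>b\<in>(R ^^ n) `` {a}. R `` {b})" by auto
  then show ?case using Suc assms by auto
qed simp

text \<open>A path of length at least \<open>k\<close> would begin with one of length
  \<open>k\<close>, so only the levels below \<open>k\<close> are inhabited, and each of them is
  finite.\<close>

lemma finite_rtrancl_Image:
  fixes R :: "'a rel"
  assumes fin: "\<And>a. finite (R `` {a})" and bound: "\<And>b. (a, b) \<notin> R ^^ k"
  shows "finite (R\<^sup>* `` {a})"
proof -
  have "n < k" if "(a, b) \<in> R ^^ n" for b n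
  proof (rule ccontr)
    assume "\<not> n < k"
    then have "R ^^ n = R ^^ k O R ^^ (n - k)" by (simp flip: relpow_add)
    then show False using that bound by auto
  qed
  then have "R\<^sup>* `` {a} \<subseteq> (\<Union>n<k. (R ^^ n) `` {a})" by (fastforce simp: rtrancl_power)
  then show ?thesis by (rule finite_subset) (intro finite_UN_I finite_relpow_Image fin, simp)
qed

lemma pred_countable_Bex:
  assumes "countable A" "\<And>i. i \<in> A \<Longrightarrow> Measurable.pred M (P i)"
  shows "Measurable.pred M (\<lambda>x. \<exists>i\<in>A. P i x)"
  using assms unfolding pred_def by (intro sets.sets_Collect_countable_Ex')

lemma pred_countable_Ball:
  assumes "countable A" "\<And>i. i \<in> A \<Longrightarrow> Measurable.pred M (P i)"
  shows "Measurable.pred M (\<lambda>x. \<forall>i\<in>A. P i x)"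
  using assms unfolding pred_def by (intro sets.sets_Collect_countable_All')

section \<open>The layer and the finiteness of its components\<close>

locale age_graph = age_space +
  assumes countable_V: "countable V"
    and N_sym: "v \<in> V \<Longrightarrow> u \<in> N v \<Longrightarrow> v \<in> N u"
    and N_irrefl: "v \<notin> N v"
begin

text \<open>This is \<open>T_2\<close>, with the cardinality bound 1 unfolded to uniqueness; as
  neighbourhoods are finite, membership is a finite combination of comparisons of ages.\<close>

definition layer :: "('a \<Rightarrow> real) \<Rightarrow> 'a set" where
  "layer x = {v \<in> V. \<forall>u\<in>N v. \<forall>w\<in>N v. x u < x v \<longrightarrow> x w < x v \<longrightarrow> u = w}"

definition adj :: "('a \<Rightarrow> real) \<Rightarrow> 'a rel" where
  "adj x = {(u, v). u \<in> layer x \<and> v \<in> layer x \<and> v \<in> N u}"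

definition up :: "('a \<Rightarrow> real) \<Rightarrow> 'a rel" where
  "up x = {(u, v) \<in> adj x. x u < x v}"

lemma layer_subset: "layer x \<subseteq> V"
  by (auto simp: layer_def)

lemma layerD: "v \<in> layer x \<Longrightarrow> u \<in> N v \<Longrightarrow> w \<in> N v \<Longrightarrow> x u < x v \<Longrightarrow> x w < x v \<Longrightarrow> u = w"
  by (auto simp: layer_def)

lemma adj_sym: "(u, v) \<in> adj x \<Longrightarrow> (v, u) \<in> adj x"
  using N_sym layer_subset by (auto simp: adj_def)

lemma adjD: "(u, v) \<in> adj x \<Longrightarrow> u \<in> layer x \<and> v \<in> layer x \<and> u \<in> V \<and> v \<in> V \<and> v \<in> N u \<and> u \<in> N v"
  using N_sym layer_subset by (auto simp: adj_def)

lemma upD: "(u, v) \<in> up x \<Longrightarrow> (u, v) \<in> adj x \<and> x u < x v"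
  by (auto simp: up_def)

lemma finite_up: "finite (up x `` {v})"
proof (cases "v \<in> V")
  case True
  then show ?thesis by (rule finite_subset[rotated, OF finite_N]) (auto simp: up_def adj_def)
next
  case False
  then have "up x `` {v} = {}" using layer_subset[of x] by (auto simp: up_def adj_def)
  then show ?thesis by simp
qed

text \<open>The next vertex \<open>u\<close> of the path has \<open>v\<close> as its only younger
  neighbour. Were \<open>u\<close> in \<open>W\<close>, the hypothesis on \<open>W\<close> would
  give it another one, younger than \<open>v\<close>. The other fresh neighbours of \<open>v\<close>
  are not younger than \<open>v\<close>, since its only younger neighbour lies in \<open>W\<close>.
  Both invariants pass to \<open>u\<close> with \<open>v\<close> as the new witness.\<close>

lemma increasing_chain:
  assumes "(v, z) \<in> up x ^^ k" "v \<in> W" "v \<in> layer x"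
    and "\<And>w. w \<in> W \<Longrightarrow> x w \<le> x v \<or> (\<exists>y\<in>N w. x y < x v)"
    and "\<exists>y\<in>W \<inter> N v. x y < x v"
  shows "chain (<) k W v x"
  using assms
proof (induction k arbitrary: v W)
  case (Suc k)
  from relpow_Suc_D2[OF Suc.prems(1)] obtain u where u: "(v, u) \<in> up x" "(u, z) \<in> up x ^^ k" by blast
  then have vu: "x v < x u" "u \<in> layer x" "v \<in> V" "u \<in> N v" "v \<in> N u" using adjD upD by blast+
  from Suc.prems obtain y where y: "y \<in> W" "y \<in> N v" "x y < x v" by auto
  have "u \<notin> W"
  proof
    assume "u \<in> W"
    then obtain y' where "y' \<in> N u" "x y' < x v" using Suc.prems(4) vu by force
    then show False using layerD[of u x y' v] vu by auto
  qed
  moreover have "x v \<le> x w" if "w \<in> N v - W - {u}" for w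
    using layerD[of v x w y] Suc.prems y that by force
  moreover have "chain (<) k (W \<union> N v) u x"
  proof (rule Suc.IH[OF u(2)])
    show "x w \<le> x u \<or> (\<exists>y\<in>N w. x y < x u)" if "w \<in> W \<union> N v" for w
      using that Suc.prems(4)[of w] vu N_sym[of v w] by force
  qed (use vu Suc.prems in auto)
  ultimately show ?case using vu by auto
qed simp

text \<open>\<open>increasing_chain\<close> demands an excluded younger neighbour, which the start
  \<open>v\<close> may lack. Excluding all neighbours but \<open>u\<close> settles the first step,
  and from \<open>u\<close> onwards \<open>v\<close> is the excluded younger neighbour.\<close>

lemma increasing_chain_from:
  assumes u: "(v, u) \<in> up x" "(u, z) \<in> up x ^^ k"
  shows "chain (<) (Suc k) (insert v (N v - {u})) v x"
proof -
  have vu: "x v < x u" "u \<in> layer x" "v \<in> V" "u \<in> N v" "v \<in> N u" using u adjD upD by blast+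
  have "chain (<) k (insert v (N v - {u}) \<union> N v) u x"
  proof (rule increasing_chain[OF u(2)])
    show "x w \<le> x u \<or> (\<exists>y\<in>N w. x y < x u)" if "w \<in> insert v (N v - {u}) \<union> N v" for w
      using that vu N_sym[of v w] by force
  qed (use vu in auto)
  then show ?thesis using vu N_irrefl by auto
qed

text \<open>All excluded vertices are at least as old as the current one, so the next vertex, being
  younger, is fresh. It is the only younger neighbour of \<open>v\<close>, so excluding the others
  preserves the invariant.\<close>

lemma decreasing_chain:
  assumes "(v, z) \<in> ((up x)\<inverse>) ^^ k" "v \<in> W" "v \<in> layer x" "\<And>w. w \<in> W \<Longrightarrow> x v \<le> x w"
  shows "chain (>) k W v x"
  using assms
proof (induction k arbitrary: v W)
  case (Suc k)
  from relpow_Suc_D2[OF Suc.prems(1)] obtain u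
    where u: "(u, v) \<in> up x" "(u, z) \<in> ((up x)\<inverse>) ^^ k" by blast
  then have vu: "x u < x v" "u \<in> layer x" "v \<in> V" "u \<in> N v" "v \<in> N u" using adjD upD by blast+
  have "u \<notin> W" using Suc.prems(4)[of u] vu by auto
  moreover have other: "x v \<le> x w" if "w \<in> N v" "w \<noteq> u" for w
    using layerD[of v x w u] Suc.prems that vu by force
  moreover have "chain (>) k (W \<union> N v) u x"
  proof (rule Suc.IH[OF u(2)])
    show "x u \<le> x w" if "w \<in> W \<union> N v" for w
      using that Suc.prems(4)[of w] other[of w] vu by force
  qed (use vu in auto)
  ultimately show ?case using vu by auto
qed simp

text \<open>Inside the layer a vertex has at most one smaller neighbour, so descending from any vertex
  ends at a root, and every path from the root is increasing.\<close>

lemma finite_component: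
  assumes distinct: "\<And>u v. v \<in> V \<Longrightarrow> u \<in> N v \<Longrightarrow> x u \<noteq> x v"
    and down_finite: "\<And>v. v \<in> V \<Longrightarrow> \<exists>k. \<not> chain (>) k {v} v x"
    and up_finite: "\<And>v u. v \<in> V \<Longrightarrow> u \<in> N v \<Longrightarrow> \<exists>k. \<not> chain (<) k (insert v (N v - {u})) v x"
    and v: "v \<in> layer x"
  shows "finite ((adj x)\<^sup>* `` {v})"
proof -
  let ?D = "(up x)\<inverse>"
  have up_adj: "(up x)\<^sup>* \<subseteq> (adj x)\<^sup>*" by (intro rtrancl_mono) (auto simp: up_def)
  obtain k where "\<not> chain (>) k {v} v x" using down_finite v layer_subset by blast
  then have "\<forall>z. (v, z) \<notin> ?D ^^ k" using decreasing_chain[where v = v and x = x and k = k and W = "{v}"] v by auto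
  \<comment> \<open>With \<open>k\<close> minimal, a descending path of length \<open>k - 1\<close>
    exists but cannot be prolonged; its end is the root \<open>r\<close>.\<close>
  then obtain k where k: "\<forall>z. (v, z) \<notin> ?D ^^ k" and least: "\<And>j. j < k \<Longrightarrow> \<exists>z. (v, z) \<in> ?D ^^ j"
    using exists_least_iff[of "\<lambda>k. \<forall>z. (v, z) \<notin> ?D ^^ k"] by blast
  have "k \<noteq> 0"
  proof
    assume "k = 0"
    with k show False by auto
  qed
  then obtain k' where k': "k = Suc k'" by (cases k) auto
  obtain r where r: "(v, r) \<in> ?D ^^ k'" using least[of k'] k' by auto
  have root: "(y, r) \<notin> up x" for y using k r k' by (auto simp: relcomp_unfold)
  have "(v, r) \<in> ?D\<^sup>*" using r by (auto simp: rtrancl_power)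
  then have rv: "(r, v) \<in> (adj x)\<^sup>*" using up_adj by (auto dest: rtrancl_converseD)
  have reach: "(r, u) \<in> (up x)\<^sup>*" if "(r, u) \<in> (adj x)\<^sup>*" for u
    using that
  proof (induction rule: rtrancl_induct)
    case (step u w)
    note uw = adjD[OF step(2)]
    show ?case
    proof (cases "x u < x w")
      case True
      then have "(u, w) \<in> up x" using step by (auto simp: up_def)
      then show ?thesis using step by auto
    next
      case False
      \<comment> \<open>A step to a younger \<open>w\<close> goes back: the increasing path from
        \<open>r\<close> enters \<open>u\<close> through its unique younger neighbour, which is
        \<open>w\<close>.\<close>
      then have "x w < x u" using distinct[of w u] uw by auto
      then have wu: "(w, u) \<in> up x" using step adj_sym by (auto simp: up_def)
      then have "u \<noteq> r" using root by auto
      with step obtain p where p: "(r, p) \<in> (up x)\<^sup>*" "(p, u) \<in> up x" by (auto elim: rtranclE)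
      then have "p = w" using layerD[of u x p w] uw \<open>x w < x u\<close> adjD upD by blast
      then show ?thesis using p by simp
    qed
  qed simp
  \<comment> \<open>The bound on path lengths depends on the first edge, so each upper neighbour
    \<open>u\<close> of the root is treated separately.\<close>
  have "finite ((up x)\<^sup>* `` {u})" if u: "(r, u) \<in> up x" for u
  proof -
    have ru: "r \<in> V" "u \<in> N r" using u adjD upD by blast+
    obtain k where k: "\<not> chain (<) k (insert r (N r - {u})) r x" using up_finite ru by blast
    then obtain j where "k = Suc j" by (cases k) auto
    then have "(u, z) \<notin> up x ^^ j" for z using increasing_chain_from[OF u] k by auto
    then show ?thesis by (intro finite_rtrancl_Image finite_up)
  qed
  moreover have "(up x)\<^sup>* `` {r} \<subseteq> insert r (\<Union>u\<in>up x `` {r}. (up x)\<^sup>* `` {u})"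
    by (auto elim: converse_rtranclE)
  ultimately have "finite ((up x)\<^sup>* `` {r})" using finite_up by (auto intro: finite_subset)
  moreover have "(adj x)\<^sup>* `` {v} \<subseteq> (up x)\<^sup>* `` {r}" using reach rv by (auto intro: rtrancl_trans)
  ultimately show ?thesis by (rule finite_subset[rotated])
qed

lemma AE_finite_components: "AE x in ages. \<not> (\<exists>v\<in>layer x. infinite ((adj x)\<^sup>* `` {v}))"
proof -
  have edges: "AE x in ages. \<forall>v\<in>V. \<forall>u\<in>N v. E v u x"
    if "\<And>v u. v \<in> V \<Longrightarrow> u \<in> N v \<Longrightarrow> AE x in ages. E v u x" for E
    using that finite_N countable_V by (simp add: AE_ball_countable countable_finite)
  have "AE x in ages. \<forall>v\<in>V. \<forall>u\<in>N v. x u \<noteq> x v"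
  proof (rule edges)
    show "AE x in ages. x u \<noteq> x v" if "v \<in> V" "u \<in> N v" for v u
      using that N_subset N_irrefl[of v] by (intro AE_age_distinct) auto
  qed
  moreover have "AE x in ages. \<forall>v\<in>V. \<exists>k. \<not> chain (>) k {v} v x"
    using AE_decreasing_chain_finite by (simp add: AE_ball_countable countable_V)
  moreover have "AE x in ages. \<forall>v\<in>V. \<forall>u\<in>N v. \<exists>k. \<not> chain (<) k (insert v (N v - {u})) v x"
    using N_irrefl by (intro edges AE_increasing_chain_finite)
  ultimately show ?thesis
  proof eventually_elim
    case (elim x)
    have "finite ((adj x)\<^sup>* `` {v})" if "v \<in> layer x" for v
      by (rule finite_component) (use elim that in auto)
    then show ?case by simp
  qed
qed

section \<open>Measurability of the event\<close>

lemma layer_measurable [measurable]: "Measurable.pred ages (\<lambda>x. v \<in> layer x)"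
proof (cases "v \<in> V")
  case True
  have "Measurable.pred ages (\<lambda>x. x u < x v)" if "u \<in> N v" for u
    using True that N_subset by (intro borel_measurable_pred_less age_measurable) auto
  then show ?thesis
    unfolding layer_def mem_Collect_eq
    by (intro pred_intros_logic pred_intros_finite) (use True finite_N in auto)
qed (simp add: layer_def)

lemma adj_measurable [measurable]: "Measurable.pred ages (\<lambda>x. (u, v) \<in> adj x)"
  unfolding adj_def by simp

lemma adj_relpow_measurable: "Measurable.pred ages (\<lambda>x. (u, v) \<in> adj x ^^ n)"
proof (induction n arbitrary: v)
  case (Suc n)
  have eq: "(u, v) \<in> adj x ^^ Suc n \<longleftrightarrow> (\<exists>w\<in>V. (u, w) \<in> adj x ^^ n \<and> (w, v) \<in> adj x)" for x
    by (auto simp: relcomp_unfold dest: adjD)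
  show ?case
    unfolding eq by (intro pred_countable_Bex pred_intros_logic Suc adj_measurable countable_V)
qed simp

text \<open>A set of vertices is infinite iff it leaves every finite \<open>F\<close>. As
  \<open>V\<close> is countable, it has countably many finite subsets, and the event is a countable
  combination of reachability events.\<close>

lemma component_measurable:
  "Measurable.pred ages (\<lambda>x. \<exists>v\<in>layer x. infinite ((adj x)\<^sup>* `` {v}))"
proof -
  have reach: "Measurable.pred ages (\<lambda>x. (u, v) \<in> (adj x)\<^sup>*)" for u v
    unfolding rtrancl_power by (intro pred_intros_countable adj_relpow_measurable)
  have inf: "infinite ((adj x)\<^sup>* `` {v}) \<longleftrightarrow>
      (\<forall>F\<in>{F. finite F \<and> F \<subseteq> V}. \<exists>u\<in>V - F. (v, u) \<in> (adj x)\<^sup>*)" if "v \<in> V" for v x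
  proof -
    have sub: "(adj x)\<^sup>* `` {v} \<subseteq> V" using that adjD by (auto elim: rtranclE)
    show ?thesis
    proof
      assume inf: "infinite ((adj x)\<^sup>* `` {v})"
      show "\<forall>F\<in>{F. finite F \<and> F \<subseteq> V}. \<exists>u\<in>V - F. (v, u) \<in> (adj x)\<^sup>*"
      proof
        fix F assume "F \<in> {F. finite F \<and> F \<subseteq> V}"
        then have "\<not> (adj x)\<^sup>* `` {v} \<subseteq> F" using inf by (auto dest: finite_subset)
        then show "\<exists>u\<in>V - F. (v, u) \<in> (adj x)\<^sup>*" using sub by auto
      qed
    qed (use sub in blast)
  qed
  have eq: "(\<exists>v\<in>layer x. infinite ((adj x)\<^sup>* `` {v})) \<longleftrightarrow>
      (\<exists>v\<in>V. v \<in> layer x \<and> (\<forall>F\<in>{F. finite F \<and> F \<subseteq> V}. \<exists>u\<in>V - F. (v, u) \<in> (adj x)\<^sup>*))" for x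
    using inf layer_subset by blast
  show ?thesis
    unfolding eq
    by (intro pred_countable_Bex pred_countable_Ball pred_intros_logic layer_measurable reach
         countable_V countable_Diff countable_Collect_finite_subset)
qed

end

section \<open>Transfer to the layer graph and to arbitrary iid ages\<close>

lemma (in pair_bidirected_digraph) layer_verts_2:
  assumes "locally_finite_graph G" "age_graph (pverts G) (neighbors G)"
  shows "layer_verts 2 G x = age_graph.layer (pverts G) (neighbors G) x"
proof -
  have "finite {u \<in> neighbors G v. x u < x v}" if "v \<in> pverts G" for v
    using assms(1) that by (auto simp: locally_finite_graph_def)
  then show ?thesis
    by (auto simp: layer_verts_def age_graph.layer_def[OF assms(2)] card_le_Suc0_iff_eq)
qed

text \<open>Adjacency is symmetric, so the strongly connected component of \<open>v\<close> is
  exactly the set reachable from \<open>v\<close>.\<close>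

lemma (in pair_bidirected_digraph) has_infinite_component_layer_graph:
  assumes lf: "locally_finite_graph G" and ag: "age_graph (pverts G) (neighbors G)"
  shows "has_infinite_component (layer_graph 2 G x) \<longleftrightarrow>
    (\<exists>v\<in>age_graph.layer (pverts G) (neighbors G) x.
       infinite ((age_graph.adj (pverts G) (neighbors G) x)\<^sup>* `` {v}))"
proof -
  interpret A: age_graph "pverts G" "neighbors G" by fact
  define H where "H = layer_graph 2 G x"
  have verts: "verts H = A.layer x" by (simp add: H_def layer_graph_def layer_verts_2[OF lf ag])
  have ends: "arcs_ends H = A.adj x"
    by (auto simp: H_def layer_graph_def layer_verts_2[OF lf ag] arcs_ends_def arc_to_ends_def
        A.adj_def neighbors_def induce_subgraph_def)
  interpret H: sym_digraph H
  proof
    show "tail H e \<in> verts H" "head H e \<in> verts H" if "e \<in> arcs H" for e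
      using that by (auto simp: H_def layer_graph_def)
    show "symmetric H" unfolding symmetric_def ends by (auto intro: symI A.adj_sym)
  qed
  have reach: "v \<rightarrow>\<^sup>*\<^bsub>H\<^esub> u \<longleftrightarrow> (v, u) \<in> (A.adj x)\<^sup>*" if v: "v \<in> A.layer x" for u v
  proof -
    have "u \<in> A.layer x" if "(v, u) \<in> (A.adj x)\<^sup>*" using that v A.adjD by (auto elim: rtranclE)
    then show ?thesis using H.reachable_conv v by (auto simp: verts ends)
  qed
  show ?thesis
    unfolding H_def[symmetric]
  proof
    assume "has_infinite_component H"
    then obtain C where C: "C \<in> H.sccs" "infinite (verts C)" by (auto simp: has_infinite_component_def)
    then have "verts C \<in> H.sccs_verts" by (auto simp: H.sccs_verts_conv)
    then obtain v where v: "v \<in> verts C" "v \<in> A.layer x" "\<forall>u\<in>verts C. v \<rightarrow>\<^sup>*\<^bsub>H\<^esub> u"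
      using H.sccs_verts_subsets[of "verts C"] by (auto simp: H.in_sccs_verts_conv_reachable verts)
    then have "verts C \<subseteq> (A.adj x)\<^sup>* `` {v}" using reach by auto
    then show "\<exists>v\<in>A.layer x. infinite ((A.adj x)\<^sup>* `` {v})" using C v by (auto dest: finite_subset)
  next
    assume "\<exists>v\<in>A.layer x. infinite ((A.adj x)\<^sup>* `` {v})"
    then obtain v where v: "v \<in> A.layer x" "infinite ((A.adj x)\<^sup>* `` {v})" by blast
    have "H \<restriction> {u. v \<rightarrow>\<^sup>*\<^bsub>H\<^esub> u} \<in> H.sccs" using v by (intro H.induce_reachable_is_in_sccs) (simp add: verts)
    moreover have "{u. v \<rightarrow>\<^sup>*\<^bsub>H\<^esub> u} = (A.adj x)\<^sup>* `` {v}" using reach v by auto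
    ultimately show "has_infinite_component H"
      using v unfolding has_infinite_component_def by (metis induce_subgraph_verts)
  qed
qed

text \<open>Points of the product space are \<open>undefined\<close> outside the index set, whereas
  the layer graph reads only ages of vertices.\<close>

lemma (in pair_bidirected_digraph) layer_graph_restrict:
  "layer_graph k G (restrict x (pverts G)) = layer_graph k G x"
proof -
  have "{u \<in> neighbors G v. restrict x (pverts G) u < restrict x (pverts G) v} = {u \<in> neighbors G v. x u < x v}"
    if "v \<in> pverts G" for v
    using that in_arcsD2 by (auto simp: neighbors_def)
  then have "layer_verts k G (restrict x (pverts G)) = layer_verts k G x"
    unfolding layer_verts_def by auto
  then show ?thesis by (simp add: layer_graph_def)
qed

theorem theorem2:
  fixes G :: "'a pair_pre_digraph" and M :: "'w measure" and X :: "'a \<Rightarrow> 'w \<Rightarrow> real"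
  assumes "pair_bidirected_digraph G"
    and "locally_finite_graph G"
    and "countable (pverts G)"
    and "prob_space M"
    and "iid_uniform_ages M (pverts G) X"
  shows "{\<omega> \<in> space M. has_infinite_component (layer_graph 2 G (\<lambda>v. X v \<omega>))} \<in> sets M \<and>
    \<P>(\<omega> in M. has_infinite_component (layer_graph 2 G (\<lambda>v. X v \<omega>))) = 0"
proof -
  interpret G: pair_bidirected_digraph G by fact
  interpret M: prob_space M by fact
  have ag: "age_graph (pverts G) (neighbors G)"
  proof
    show "v \<in> neighbors G u" if "u \<in> neighbors G v" for u v
      using that G.pair_sym_arcs by (auto simp: neighbors_def symmetric_def elim: symE)
    show "v \<notin> neighbors G v" for v using G.pair_no_loops by (fastforce simp: neighbors_def)
    show "neighbors G v \<subseteq> pverts G" for v using G.in_arcsD2 by (auto simp: neighbors_def)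
  qed (use assms in \<open>auto simp: locally_finite_graph_def\<close>)
  interpret A: age_graph "pverts G" "neighbors G" by (rule ag)
  define f where "f \<omega> = (\<lambda>v\<in>pverts G. X v \<omega>)" for \<omega>
  let ?I = "\<lambda>x. has_infinite_component (layer_graph 2 G x)"
  have indep: "M.indep_vars (\<lambda>_. borel) X (pverts G)"
    and unif: "\<And>v. v \<in> pverts G \<Longrightarrow> distr M borel (X v) = unif"
    using assms by (auto simp: iid_uniform_ages_def)
  have X: "X v \<in> borel_measurable M" if "v \<in> pverts G" for v
    using indep that by (auto simp: M.indep_vars_def)
  have sets: "sets (PiM (pverts G) (\<lambda>_. borel)) = sets A.ages"
    unfolding A.ages_def by (intro sets_PiM_cong) auto
  have f: "f \<in> M \<rightarrow>\<^sub>M A.ages"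
    unfolding f_def measurable_cong_sets[OF refl sets[symmetric]] using X by measurable
  note inf_iff = G.has_infinite_component_layer_graph[OF assms(2) ag]
  have m[measurable]: "Measurable.pred A.ages ?I"
    unfolding inf_iff by (rule A.component_measurable)
  have "AE \<omega> in M. \<not> ?I (f \<omega>)"
  \<comment> \<open>The description of independence by the joint distribution is applied to a
    nonempty index set; with no vertices the layer is empty.\<close>
  proof (cases "pverts G = {}")
    case True
    then show ?thesis using A.layer_subset by (auto simp: inf_iff)
  next
    case False
    have "distr M A.ages f = distr M (PiM (pverts G) (\<lambda>_. borel)) f"
      by (intro distr_cong) (auto simp: sets)
    also have "\<dots> = PiM (pverts G) (\<lambda>v. distr M borel (X v))"
      using M.indep_vars_iff_distr_eq_PiM'[OF False X, of "\<lambda>v. v"] indep by (simp add: f_def[abs_def])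
    also have "\<dots> = A.ages" unfolding A.ages_def by (intro PiM_cong unif refl)
    finally have distr: "distr M A.ages f = A.ages" .
    show ?thesis
      by (rule AE_distrD[OF f]) (unfold distr inf_iff, rule A.AE_finite_components)
  qed
  moreover have If: "?I (f \<omega>) \<longleftrightarrow> ?I (\<lambda>v. X v \<omega>)" for \<omega>
    unfolding f_def by (simp add: G.layer_graph_restrict)
  ultimately have ae: "AE \<omega> in M. \<not> ?I (\<lambda>v. X v \<omega>)" by simp
  have "Measurable.pred M (\<lambda>\<omega>. ?I (f \<omega>))" by (rule measurable_compose[OF f m])
  then have "{\<omega> \<in> space M. ?I (\<lambda>v. X v \<omega>)} \<in> sets M" by (simp add: If pred_def)
  then show ?thesis using ae by (simp add: M.prob_eq_0)
qed

end
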